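(* Let $m\ge1$ be an integer, let $p=3m(m+1)+1$, and let $q\ge5$ be a prime with $q\equiv2\pmod 3$. Then $q\nmid p$. *)

theory Defs
  imports "HOL-Number_Theory.Number_Theory"
begin

end

theory Submission
  imports Defs
begin

text \<open>
  The number \<open>3 * m * (m + 1) + 1\<close> is the difference \<open>(m + 1)^3 - m^3\<close> of consecutive cubes.
  If \<open>q\<close> is a prime with \<open>q \<equiv> 2 (mod 3)\<close>, then \<open>3\<close> is coprime to the order \<open>q - 1\<close> of
  the multiplicative group modulo \<open>q\<close>, so cubing is injective modulo \<open>q\<close>
  (\<open>cong_of_cong_cubes\<close>). A prime of this kind dividing the difference would therefore give
  \<open>m + 1 \<equiv> m (mod q)\<close>, which is absurd.
\<close>

lemma fermat_cong_power_prime: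
  fixes q x :: nat
  assumes "prime q"
  shows "[x ^ q = x] (mod q)"
proof (cases "q dvd x")
  case True
  moreover have "q dvd x ^ q"
    using True prime_gt_0_nat[OF assms] by (meson dvd_power dvd_trans)
  ultimately show ?thesis
    by (simp add: cong_def dvd_eq_mod_eq_0)
next
  case False
  have "[x * x ^ (q - 1) = x * 1] (mod q)"
    using fermat_theorem[OF assms False] by (rule cong_scalar_left)
  moreover have "x * x ^ (q - 1) = x ^ q"
    using prime_gt_0_nat[OF assms] by (simp flip: power_Suc)
  ultimately show ?thesis by simp
qed

text \<open>
  Cubing has an explicit inverse: for \<open>q = 3 * k + 2\<close> the exponent \<open>2 * q - 1 = 3 * (2 * k + 1)\<close>
  is a multiple of \<open>3\<close> and is congruent to \<open>1\<close> modulo \<open>q - 1\<close>, so raising \<open>x^3\<close> to the power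
  \<open>2 * k + 1\<close> returns \<open>x\<close>, also when \<open>q\<close> divides \<open>x\<close>.
\<close>

lemma cong_of_cong_cubes:
  fixes q x y :: nat
  assumes "prime q" and "[q = 2] (mod 3)" and "[x ^ 3 = y ^ 3] (mod q)"
  shows "[x = y] (mod q)"
proof -
  define k where "k = q div 3"
  have q: "q = 3 * k + 2"
    using assms(2) div_mult_mod_eq[of q 3] by (simp add: k_def cong_def)
  have inverse: "[(z ^ 3) ^ (2 * k + 1) = z] (mod q)" for z :: nat
  proof -
    have "(z ^ 3) ^ (2 * k + 1) = z ^ q * z ^ (q - 1)"
    proof -
      have "3 * (2 * k + 1) = q + (q - 1)"
        by (simp add: q)
      then show ?thesis
        by (metis power_mult power_add)
    qed
    also have "[\<dots> = z * z ^ (q - 1)] (mod q)"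
      using fermat_cong_power_prime[OF assms(1)] by (rule cong_scalar_right)
    also have "z * z ^ (q - 1) = z ^ q"
      by (simp add: q)
    also have "[\<dots> = z] (mod q)"
      by (rule fermat_cong_power_prime[OF assms(1)])
    finally show ?thesis .
  qed
  have "[(x ^ 3) ^ (2 * k + 1) = (y ^ 3) ^ (2 * k + 1)] (mod q)"
    using assms(3) by (rule cong_pow)
  then show ?thesis
    using inverse[of x] inverse[of y] by (metis cong_sym cong_trans)
qed

theorem theorem3p11:
  fixes m p q :: nat
  assumes "m \<ge> 1"
    and "p = 3 * m * (m + 1) + 1"
    and "prime q"
    and "q \<ge> 5"
    and "[q = 2] (mod 3)"
  shows "\<not> q dvd p"
proof
  assume "q dvd p"
  have "(m + 1) ^ 3 = m ^ 3 + p"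
    by (simp add: assms(2) power3_eq_cube algebra_simps)
  then have "[(m + 1) ^ 3 = m ^ 3] (mod q)"
    using \<open>q dvd p\<close> by (auto simp: cong_def elim!: dvdE)
  then have "[m + 1 = m] (mod q)"
    by (rule cong_of_cong_cubes[OF assms(3,5)])
  then have "q dvd 1"
    by (metis cong_add_lcancel_0_nat cong_0_iff)
  then show False
    using assms(4) by simp
qed

end
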